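(* Let $\mathcal{B}$ be an unconditional basis in a quasi-Banach space $\mathbb{B}$ such that $h_\ell(N)\lesssim N^{\beta_0}$ and $h_r(N)\gtrsim N^{\beta_1}$ for some $\beta_1>\beta_0\ge0$. Then $\mathscr{G}^\alpha_\tau(\mathcal{B},\mathbb{B})\neq\mathcal{A}^\alpha_\tau(\mathcal{B},\mathbb{B})$ for all $\alpha>0$ and all $\tau\in(0,\infty]$.
   Context: Basis. $(\mathbb{B},\|\cdot\|_{\mathbb{B}})$ is a quasi-Banach space whose quasi-norm satisfies $\|x+y\|_{\mathbb{B}}^{\rho}\le\|x\|_{\mathbb{B}}^{\rho}+\|y\|_{\mathbb{B}}^{\rho}$ for some fixed $\rho\in(0,1]$. A sequence $\mathcal{B}=\{e_j\}_{j=1}^\infty$ is a basis if each $x\in\mathbb{B}$ is uniquely $x=\sum_j c_je_j$ with convergence in $\|\cdot\|_{\mathbb{B}}$; it is unconditional (with constant $K$) if $\|\sum_j\lambda_jc_je_j\|_{\mathbb{B}}\le K\|\sum_jc_je_j\|_{\mathbb{B}}$ whenever $|\lambda_j|\le1$. Standing assumptions: $\|e_j\|_{\mathbb{B}}=1$ for all $j$ and $K=1$. Democracy functions. $h_r(N)=\sup_{|\Gamma|=N}\|\sum_{k\in\Gamma}e_k\|_{\mathbb{B}}$ and $h_\ell(N)=\inf_{|\Gamma|=N}\|\sum_{k\in\Gamma}e_k\|_{\mathbb{B}}$, over $\Gamma\subset\mathbb{N}$, $N=1,2,\dots$. Approximation spaces and greedy classes. $\Sigma_N$ is the set of $y\in\mathbb{B}$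 with at most $N$ nonzero coefficients; $\sigma_N(x)=\inf_{y\in\Sigma_N}\|x-y\|_{\mathbb{B}}$. For $x=\sum_jc_je_j$, and any bijection $\pi$ of $\mathbb{N}$ with $|c_{\pi(j)}|\ge|c_{\pi(j+1)}|$ for all $j$, let $G_N^\pi(x)=\sum_{j=1}^Nc_{\pi(j)}e_{\pi(j)}$, and $\gamma_N(x)=\sup_\pi\|x-G_N^\pi(x)\|_{\mathbb{B}}$ over all such $\pi$. For $\alpha>0$, $0<\tau\le\infty$, $\mathcal{A}^\alpha_\tau(\mathcal{B},\mathbb{B})$ is the set of $x\in\mathbb{B}$ with $\|x\|_{\mathcal{A}^\alpha_\tau}=\|x\|_{\mathbb{B}}+\big[\sum_{N\ge1}(N^\alpha\sigma_N(x))^\tau\frac1N\big]^{1/\tau}<\infty$ (with $\sup_{N\ge1}N^\alpha\sigma_N(x)$ instead of the bracket if $\tau=\infty$); $\mathscr{G}^\alpha_\tau(\mathcal{B},\mathbb{B})$ and $\|\cdot\|_{\mathscr{G}^\alpha_\tau}$ are defined in the same way with $\gamma_N$ in place of $\sigma_N$. $X\hookrightarrow Y$ means $X\subset Y$ and there is $C>0$ with $\|x\|_Y\le C\|x\|_X$ for all $x\in X$. Equality of spaces $X=Y$ is interpreted as $X\hookrightarrow Y$ and $Y\hookrightarrow X$, and $X\ne Y$ is its negation. $a(N)\lesssim b(N)$ means $a(N)\le Cb(N)$ for all $N\ge1$ with $C$ independent of $N$; $\gtrsim$ is the reverse.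
   Formalization: No bijection π of ℕ orders |c_j| decreasingly if x has infinite support and some zero coefficient, so γ_N(x) would be a supremum over the empty set; π is instead any injection of ℕ into ℕ whose range contains the support of x, which changes no γ_N(x) for full or finite support. *)

theory Defs
  imports Complex_Main "HOL-Library.Extended_Real"
begin

text \<open>
  The class \<^class>\<open>real_normed_field\<close> (multiplicative norm) leaves exactly the real and the
  complex scalars, by Gelfand--Mazur. Sequences are indexed from \<open>0\<close>: the basis
  \<open>e\<^sub>1, e\<^sub>2, \<dots>\<close> is written \<open>e 0, e 1, \<dots>\<close>.
\<close>

locale quasi_banach_space = vector_space scale
  for scale :: "'k::real_normed_field \<Rightarrow> 'b::ab_group_add \<Rightarrow> 'b" +
  fixes qnorm :: "'b \<Rightarrow> real" and \<rho> :: real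
  assumes rho_pos: "0 < \<rho>" and rho_le_1: "\<rho> \<le> 1"
    and qnorm_nonneg: "0 \<le> qnorm x"
    and qnorm_eq_0_iff: "qnorm x = 0 \<longleftrightarrow> x = 0"
    and qnorm_scale: "qnorm (scale c x) = norm c * qnorm x"
    and qnorm_triangle: "qnorm (x + y) powr \<rho> \<le> qnorm x powr \<rho> + qnorm y powr \<rho>"
    and qnorm_complete:
      "(\<And>\<epsilon>. \<epsilon> > 0 \<Longrightarrow> \<exists>M. \<forall>m\<ge>M. \<forall>n\<ge>M. qnorm (X m - X n) < \<epsilon>)
        \<Longrightarrow> \<exists>x. (\<lambda>n. qnorm (X n - x)) \<longlonglongrightarrow> 0"

definition expands_to ::
  "('k::real_normed_field \<Rightarrow> 'b::ab_group_add \<Rightarrow> 'b) \<Rightarrow> ('b \<Rightarrow> real) \<Rightarrow> (nat \<Rightarrow> 'b)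
    \<Rightarrow> (nat \<Rightarrow> 'k) \<Rightarrow> 'b \<Rightarrow> bool" where
  "expands_to scale qnorm e c x \<longleftrightarrow>
     (\<lambda>n. qnorm (x - (\<Sum>j<n. scale (c j) (e j)))) \<longlonglongrightarrow> 0"

definition is_basis ::
  "('k::real_normed_field \<Rightarrow> 'b::ab_group_add \<Rightarrow> 'b) \<Rightarrow> ('b \<Rightarrow> real) \<Rightarrow> (nat \<Rightarrow> 'b) \<Rightarrow> bool" where
  "is_basis scale qnorm e \<longleftrightarrow> (\<forall>x. \<exists>!c. expands_to scale qnorm e c x)"

definition unconditional_basis ::
  "('k::real_normed_field \<Rightarrow> 'b::ab_group_add \<Rightarrow> 'b) \<Rightarrow> ('b \<Rightarrow> real) \<Rightarrow> (nat \<Rightarrow> 'b) \<Rightarrow> real \<Rightarrow> bool"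
where
  "unconditional_basis scale qnorm e K \<longleftrightarrow>
     is_basis scale qnorm e \<and>
     (\<forall>c x l. expands_to scale qnorm e c x \<longrightarrow> (\<forall>j. norm (l j) \<le> 1) \<longrightarrow>
        (\<exists>y. expands_to scale qnorm e (\<lambda>j. l j * c j) y \<and> qnorm y \<le> K * qnorm x))"

definition coeffs ::
  "('k::real_normed_field \<Rightarrow> 'b::ab_group_add \<Rightarrow> 'b) \<Rightarrow> ('b \<Rightarrow> real) \<Rightarrow> (nat \<Rightarrow> 'b)
    \<Rightarrow> 'b \<Rightarrow> nat \<Rightarrow> 'k" where
  "coeffs scale qnorm e x = (THE c. expands_to scale qnorm e c x)"

text \<open>
  The suprema and infima below are taken in \<^typ>\<open>real\<close>. For a normalized basis with
  unconditionality constant \<open>1\<close> they all range over nonempty bounded sets: for example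
  \<open>h_right qnorm e N \<le> N powr (1/\<rho>)\<close>, and greedy errors of \<open>x\<close> are at most \<open>qnorm x\<close>.
\<close>

definition h_right :: "('b::ab_group_add \<Rightarrow> real) \<Rightarrow> (nat \<Rightarrow> 'b) \<Rightarrow> nat \<Rightarrow> real" where
  "h_right qnorm e N = (SUP \<Gamma>\<in>{\<Gamma>. finite \<Gamma> \<and> card \<Gamma> = N}. qnorm (\<Sum>k\<in>\<Gamma>. e k))"

definition h_left :: "('b::ab_group_add \<Rightarrow> real) \<Rightarrow> (nat \<Rightarrow> 'b) \<Rightarrow> nat \<Rightarrow> real" where
  "h_left qnorm e N = (INF \<Gamma>\<in>{\<Gamma>. finite \<Gamma> \<and> card \<Gamma> = N}. qnorm (\<Sum>k\<in>\<Gamma>. e k))"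

definition lesssim :: "(nat \<Rightarrow> real) \<Rightarrow> (nat \<Rightarrow> real) \<Rightarrow> bool" (infix "\<lesssim>" 50) where
  "a \<lesssim> b \<longleftrightarrow> (\<exists>C>0. \<forall>N\<ge>1. a N \<le> C * b N)"

definition Sigma_set ::
  "('k::real_normed_field \<Rightarrow> 'b::ab_group_add \<Rightarrow> 'b) \<Rightarrow> ('b \<Rightarrow> real) \<Rightarrow> (nat \<Rightarrow> 'b)
    \<Rightarrow> nat \<Rightarrow> 'b set" where
  "Sigma_set scale qnorm e N =
     {y. finite {j. coeffs scale qnorm e y j \<noteq> 0} \<and> card {j. coeffs scale qnorm e y j \<noteq> 0} \<le> N}"

definition sigma_err ::
  "('k::real_normed_field \<Rightarrow> 'b::ab_group_add \<Rightarrow> 'b) \<Rightarrow> ('b \<Rightarrow> real) \<Rightarrow> (nat \<Rightarrow> 'b)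
    \<Rightarrow> nat \<Rightarrow> 'b \<Rightarrow> real" where
  "sigma_err scale qnorm e N x = (INF y\<in>Sigma_set scale qnorm e N. qnorm (x - y))"

text \<open>
  A sequence with infinitely many nonzero terms and at least one zero term has no decreasing
  rearrangement by a bijection of the index set, since zeros would have to come after all nonzero
  terms. We therefore ask for an injection whose range contains the support. If some bijection
  rearranges \<open>c\<close> decreasingly (finite or full support), this produces exactly the same greedy sums
  as the bijections do.
\<close>

definition greedy_ordering :: "(nat \<Rightarrow> 'k::real_normed_field) \<Rightarrow> (nat \<Rightarrow> nat) \<Rightarrow> bool" where
  "greedy_ordering c p \<longleftrightarrow>
     inj p \<and> {j. c j \<noteq> 0} \<subseteq> range p \<and> (\<forall>j. norm (c (p j)) \<ge> norm (c (p (Suc j))))"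

definition greedy_sum ::
  "('k::real_normed_field \<Rightarrow> 'b::ab_group_add \<Rightarrow> 'b) \<Rightarrow> ('b \<Rightarrow> real) \<Rightarrow> (nat \<Rightarrow> 'b)
    \<Rightarrow> (nat \<Rightarrow> nat) \<Rightarrow> nat \<Rightarrow> 'b \<Rightarrow> 'b" where
  "greedy_sum scale qnorm e p N x = (\<Sum>j<N. scale (coeffs scale qnorm e x (p j)) (e (p j)))"

definition gamma_err ::
  "('k::real_normed_field \<Rightarrow> 'b::ab_group_add \<Rightarrow> 'b) \<Rightarrow> ('b \<Rightarrow> real) \<Rightarrow> (nat \<Rightarrow> 'b)
    \<Rightarrow> nat \<Rightarrow> 'b \<Rightarrow> real" where
  "gamma_err scale qnorm e N x =
     (SUP p\<in>{p. greedy_ordering (coeffs scale qnorm e x) p}. qnorm (x - greedy_sum scale qnorm e p N x))"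

text \<open>
  For a sequence \<open>a\<close> of nonnegative errors, \<open>rate_finite \<alpha> \<tau> a\<close> says that the bracket
  \<open>[\<Sum>\<^sub>N\<^sub>\<ge>\<^sub>1 (N\<^sup>\<alpha> a\<^sub>N)\<^sup>\<tau> / N]\<close> raised to the power \<open>1/\<tau>\<close> (the supremum if \<open>\<tau> = \<infinity>\<close>) is finite, and
  \<open>rate \<alpha> \<tau> a\<close> is its value in that case; the value of \<open>a\<close> at \<open>0\<close> plays no role.
\<close>

definition rate_finite :: "real \<Rightarrow> ereal \<Rightarrow> (nat \<Rightarrow> real) \<Rightarrow> bool" where
  "rate_finite \<alpha> \<tau> a \<longleftrightarrow>
     (if \<tau> = \<infinity> then bdd_above ((\<lambda>N. real N powr \<alpha> * a N) ` {1..})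
      else summable (\<lambda>n. (real (Suc n) powr \<alpha> * a (Suc n)) powr real_of_ereal \<tau> / real (Suc n)))"

definition rate :: "real \<Rightarrow> ereal \<Rightarrow> (nat \<Rightarrow> real) \<Rightarrow> real" where
  "rate \<alpha> \<tau> a =
     (if \<tau> = \<infinity> then (SUP N\<in>{1..}. real N powr \<alpha> * a N)
      else (\<Sum>n. (real (Suc n) powr \<alpha> * a (Suc n)) powr real_of_ereal \<tau> / real (Suc n))
             powr (1 / real_of_ereal \<tau>))"

text \<open>A quasi-normed space inside the ambient one: its elements together with its quasi-norm.\<close>

type_synonym 'b qspace = "'b set \<times> ('b \<Rightarrow> real)"

definition approx_space ::
  "('k::real_normed_field \<Rightarrow> 'b::ab_group_add \<Rightarrow> 'b) \<Rightarrow> ('b \<Rightarrow> real) \<Rightarrow> (nat \<Rightarrow> 'b)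
    \<Rightarrow> real \<Rightarrow> ereal \<Rightarrow> 'b qspace" where
  "approx_space scale qnorm e \<alpha> \<tau> =
     ({x. rate_finite \<alpha> \<tau> (\<lambda>N. sigma_err scale qnorm e N x)},
      \<lambda>x. qnorm x + rate \<alpha> \<tau> (\<lambda>N. sigma_err scale qnorm e N x))"

definition greedy_class ::
  "('k::real_normed_field \<Rightarrow> 'b::ab_group_add \<Rightarrow> 'b) \<Rightarrow> ('b \<Rightarrow> real) \<Rightarrow> (nat \<Rightarrow> 'b)
    \<Rightarrow> real \<Rightarrow> ereal \<Rightarrow> 'b qspace" where
  "greedy_class scale qnorm e \<alpha> \<tau> =
     ({x. rate_finite \<alpha> \<tau> (\<lambda>N. gamma_err scale qnorm e N x)},
      \<lambda>x. qnorm x + rate \<alpha> \<tau> (\<lambda>N. gamma_err scale qnorm e N x))"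

definition embeds :: "'b qspace \<Rightarrow> 'b qspace \<Rightarrow> bool" (infix "\<hookrightarrow>" 50) where
  "X \<hookrightarrow> Y \<longleftrightarrow> fst X \<subseteq> fst Y \<and> (\<exists>C>0. \<forall>x\<in>fst X. snd Y x \<le> C * snd X x)"

definition same_space :: "'b qspace \<Rightarrow> 'b qspace \<Rightarrow> bool" where
  "same_space X Y \<longleftrightarrow> X \<hookrightarrow> Y \<and> Y \<hookrightarrow> X"

end

theory Submission
  imports Defs
begin

text \<open>
  Write \<open>1\<^sub>A\<close> for \<open>\<Sum>j\<in>A. e j\<close>. The embedding of the approximation space into the greedy class fails
  because the greedy algorithm sees only the sizes of the coefficients, and a vector \<open>1\<^sub>A\<close> leaves
  their order completely open. Let \<open>A = G \<union> F\<close> where \<open>G\<close> has \<open>(k + 1) q\<close> elements but \<open>1\<^sub>G\<close> is short,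
  and \<open>F\<close> has only \<open>q\<close> elements but \<open>1\<^sub>F\<close> is long, of length \<open>R\<close>. A good approximation of \<open>1\<^sub>A\<close> takes
  the indices in \<open>F\<close> first: after \<open>q\<close> steps the error is at most the length of \<open>1\<^sub>G\<close>, and after
  \<open>(k + 2) q\<close> steps it is \<open>0\<close>. An unlucky greedy ordering takes \<open>G - F\<close> first, so that for \<open>k q\<close>
  steps all of \<open>1\<^sub>F\<close> remains in the error.

  If the length of \<open>1\<^sub>G\<close> is at most \<open>(k + 2)\<^sup>-\<^sup>\<alpha> R\<close>, the norm of \<open>1\<^sub>A\<close> in the approximation space is
  thus of order at most \<open>q\<^sup>\<alpha> R\<close> (\<open>rate_upper_bound\<close>), while its norm in the greedy class is of order
  at least \<open>(k q)\<^sup>\<alpha> R\<close> (\<open>rate_lower_bound\<close>). The quotient \<open>k\<^sup>\<alpha>\<close> is unbounded. The assumptions on the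
  democracy functions enter only through the existence of \<open>G\<close> and \<open>F\<close> for each fixed \<open>k\<close>
  (\<open>unbalanced_index_sets\<close>): the lengths can be taken of order \<open>(k q)\<^sup>\<beta>\<^sup>0\<close> at most and \<open>q\<^sup>\<beta>\<^sup>1\<close> at
  least, and \<open>q\<close> may be as large as needed.
\<close>

section \<open>Power sums and the rate functional\<close>

lemma nat_powr_unbounded:
  fixes s T :: real
  assumes "s > 0"
  obtains n :: nat where "T \<le> real n powr s" "n \<ge> 1"
proof -
  obtain m :: nat where m: "\<bar>T\<bar> powr (1 / s) \<le> real m" using real_arch_simple by blast
  have "T \<le> (\<bar>T\<bar> powr (1 / s)) powr s" using assms by (simp add: powr_powr)
  also have "\<dots> \<le> real (Suc m) powr s" using m assms by (intro powr_mono2) auto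
  finally show ?thesis by (intro that[of "Suc m"]) auto
qed

lemma powr_diff_mvt:
  fixes s :: real
  assumes "k \<ge> 1"
  obtains z where "real k < z" "z < real (Suc k)"
    "real (Suc k) powr s - real k powr s = s * z powr (s - 1)"
proof -
  have "\<exists>z. real k < z \<and> z < real (Suc k) \<and>
      real (Suc k) powr s - real k powr s = (real (Suc k) - real k) * (s * z powr (s - 1))"
    by (rule MVT2) (use assms in \<open>auto intro!: has_real_derivative_powr\<close>)
  then show ?thesis using that by auto
qed

lemma powr_diff_le:
  fixes s :: real
  assumes "s \<ge> 1"
  shows "real (Suc k) powr s - real k powr s \<le> s * real (Suc k) powr (s - 1)"
proof (cases "k = 0")
  case False
  then obtain z where z: "real k < z" "z < real (Suc k)"
    "real (Suc k) powr s - real k powr s = s * z powr (s - 1)"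
    using powr_diff_mvt[of k s] by auto
  have "z powr (s - 1) \<le> real (Suc k) powr (s - 1)"
    using z assms by (intro powr_mono2) auto
  then show ?thesis using z assms by (auto intro: mult_left_mono)
qed (use assms in auto)

lemma powr_diff_ge:
  fixes s :: real
  assumes "0 < s" "s \<le> 1"
  shows "s * real (Suc k) powr (s - 1) \<le> real (Suc k) powr s - real k powr s"
proof (cases "k = 0")
  case False
  then obtain z where z: "real k < z" "z < real (Suc k)"
    "real (Suc k) powr s - real k powr s = s * z powr (s - 1)"
    using powr_diff_mvt[of k s] by auto
  have "real (Suc k) powr (s - 1) \<le> z powr (s - 1)"
    using z assms by (intro powr_mono2') auto
  then show ?thesis using z assms by (auto intro: mult_left_mono)
qed (use assms in auto)

lemma sum_powr_telescope:
  fixes s :: real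
  shows "(\<Sum>k<n. real (Suc k) powr s - real k powr s) = real n powr s"
  using sum_lessThan_telescope[of "\<lambda>k. real k powr s" n] by simp

lemma real_mult_powr_minus_one: "real n * real n powr (s - 1) = real n powr s"
  by (cases "n = 0") (auto simp: powr_diff)

text \<open>
  One of the two bounds compares the sum with a telescoping sum, the other replaces every term by
  the last one; which of them does which depends on whether \<open>k\<^sup>s\<^sup>-\<^sup>1\<close> increases or decreases.
\<close>

lemma sum_powr_le:
  fixes s :: real
  assumes "0 < s"
  shows "(\<Sum>k<n. real (Suc k) powr (s - 1)) \<le> max 1 (1 / s) * real n powr s"
proof (cases "s \<ge> 1")
  case True
  have "(\<Sum>k<n. real (Suc k) powr (s - 1)) \<le> (\<Sum>k<n. real n powr (s - 1))"
    using True by (intro sum_mono powr_mono2) auto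
  also have "\<dots> = real n powr s" by (simp add: real_mult_powr_minus_one)
  also have "\<dots> = max 1 (1 / s) * real n powr s" using True by (simp add: max_def field_simps)
  finally show ?thesis .
next
  case False
  have "s * (\<Sum>k<n. real (Suc k) powr (s - 1)) \<le> real n powr s"
    using False assms powr_diff_ge[of s]
    by (subst sum_powr_telescope[symmetric], unfold sum_distrib_left) (auto intro!: sum_mono)
  then have "(\<Sum>k<n. real (Suc k) powr (s - 1)) \<le> 1 / s * real n powr s"
    using assms by (simp add: field_simps)
  also have "\<dots> \<le> max 1 (1 / s) * real n powr s" by (intro mult_right_mono) auto
  finally show ?thesis .
qed

lemma sum_powr_ge:
  fixes s :: real
  assumes "0 < s"
  shows "min 1 (1 / s) * real n powr s \<le> (\<Sum>k<n. real (Suc k) powr (s - 1))"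
proof (cases "s \<ge> 1")
  case True
  have "real n powr s \<le> s * (\<Sum>k<n. real (Suc k) powr (s - 1))"
    using True powr_diff_le[of s]
    by (subst sum_powr_telescope[symmetric], unfold sum_distrib_left) (auto intro!: sum_mono)
  then have "1 / s * real n powr s \<le> (\<Sum>k<n. real (Suc k) powr (s - 1))"
    using assms by (simp add: field_simps)
  moreover have "min 1 (1 / s) * real n powr s \<le> 1 / s * real n powr s"
    by (intro mult_right_mono) auto
  ultimately show ?thesis by linarith
next
  case False
  have "min 1 (1 / s) * real n powr s \<le> 1 * real n powr s" by (intro mult_right_mono) auto
  also have "\<dots> = (\<Sum>k<n. real n powr (s - 1))" by (simp add: real_mult_powr_minus_one)
  also have "\<dots> \<le> (\<Sum>k<n. real (Suc k) powr (s - 1))"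
    using False by (intro sum_mono powr_mono2') auto
  finally show ?thesis .
qed

lemma rate_term_eq:
  fixes a t :: real
  assumes "a \<ge> 0"
  shows "(real (Suc n) powr \<alpha> * a) powr t / real (Suc n) = real (Suc n) powr (\<alpha> * t - 1) * a powr t"
  using assms by (simp add: powr_mult powr_powr powr_diff del: of_nat_Suc)

text \<open>
  A plateau of height \<open>R\<close> up to \<open>n\<close> contributes \<open>n\<^sup>\<alpha> R\<close> to the rate, for every \<open>\<tau>\<close>: for finite \<open>\<tau>\<close>
  the sum of \<open>N\<^sup>\<alpha>\<^sup>\<tau>\<^sup>-\<^sup>1\<close> over the plateau is of order \<open>n\<^sup>\<alpha>\<^sup>\<tau>\<close>. The constant must not depend on the
  sequence, so it is obtained before the sequence is chosen.
\<close>

lemma rate_lower_bound: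
  fixes \<alpha> :: real and \<tau> :: ereal
  assumes "\<alpha> > 0" "\<tau> > 0"
  obtains c where "c > 0"
    "\<And>a n R. \<lbrakk>rate_finite \<alpha> \<tau> a; R \<ge> 0; \<And>N. 1 \<le> N \<Longrightarrow> N \<le> n \<Longrightarrow> R \<le> a N; n \<ge> 1\<rbrakk>
       \<Longrightarrow> c * real n powr \<alpha> * R \<le> rate \<alpha> \<tau> a"
proof (cases "\<tau> = \<infinity>")
  case True
  have "1 * real n powr \<alpha> * R \<le> rate \<alpha> \<tau> a"
    if "rate_finite \<alpha> \<tau> a" "R \<ge> 0" "\<And>N. 1 \<le> N \<Longrightarrow> N \<le> n \<Longrightarrow> R \<le> a N" "n \<ge> 1" for a n R
  proof -
    have "real n powr \<alpha> * R \<le> real n powr \<alpha> * a n" using that by (intro mult_left_mono) auto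
    also have "\<dots> \<le> (SUP N\<in>{1..}. real N powr \<alpha> * a N)"
      using that True by (intro cSUP_upper) (auto simp: rate_finite_def)
    finally show ?thesis using True by (simp add: rate_def)
  qed
  then show ?thesis by (intro that[of 1]) auto
next
  case False
  define t where "t = real_of_ereal \<tau>"
  have t: "t > 0" using assms False by (cases \<tau>) (auto simp: t_def)
  define s where "s = \<alpha> * t"
  have s: "s > 0" using t assms by (simp add: s_def)
  define m where "m = min 1 (1 / s)"
  have m: "m > 0" using s by (simp add: m_def)
  have "m powr (1 / t) * real n powr \<alpha> * R \<le> rate \<alpha> \<tau> a"
    if fin: "rate_finite \<alpha> \<tau> a" and R: "R \<ge> 0"
      and a: "\<And>N. 1 \<le> N \<Longrightarrow> N \<le> n \<Longrightarrow> R \<le> a N" and n: "n \<ge> 1" for a n R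
  proof -
    let ?f = "\<lambda>k. (real (Suc k) powr \<alpha> * a (Suc k)) powr t / real (Suc k)"
    have "m * (real n powr \<alpha> * R) powr t = (m * real n powr s) * R powr t"
      using R by (simp add: powr_mult powr_powr s_def)
    also have "\<dots> \<le> (\<Sum>k<n. real (Suc k) powr (s - 1)) * R powr t"
      using sum_powr_ge[OF s, of n] by (intro mult_right_mono) (auto simp: m_def)
    also have "\<dots> = (\<Sum>k<n. (real (Suc k) powr \<alpha> * R) powr t / real (Suc k))"
      by (simp only: rate_term_eq[OF R] s_def sum_distrib_right)
    also have "\<dots> \<le> (\<Sum>k<n. ?f k)"
      using R t a by (intro sum_mono divide_right_mono powr_mono2 mult_left_mono mult_nonneg_nonneg) auto
    also have "\<dots> \<le> (\<Sum>k. ?f k)"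
      using fin False by (intro sum_le_suminf) (auto simp: rate_finite_def t_def)
    finally have "(m * (real n powr \<alpha> * R) powr t) powr (1 / t) \<le> (\<Sum>k. ?f k) powr (1 / t)"
      using t m by (intro powr_mono2) auto
    moreover have "(m * (real n powr \<alpha> * R) powr t) powr (1 / t) = m powr (1 / t) * real n powr \<alpha> * R"
      using t m R by (simp add: powr_mult powr_powr)
    ultimately show ?thesis using False by (simp add: rate_def t_def)
  qed
  then show ?thesis using m by (intro that[of "m powr (1 / t)"]) auto
qed

text \<open>
  The matching estimate from above for a sequence below the sum of two plateaus, of height \<open>R\<close> up to
  \<open>q\<close> and of height \<open>L\<close> up to \<open>m\<close>.
\<close>

lemma rate_upper_bound:
  fixes \<alpha> :: real and \<tau> :: ereal
  assumes "\<alpha> > 0" "\<tau> > 0"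
  obtains C where "C > 0"
    "\<And>a q m R L. \<lbrakk>\<And>N. 0 \<le> a N; \<And>N. a N \<le> R; \<And>N. q \<le> N \<Longrightarrow> a N \<le> L;
        \<And>N. m \<le> N \<Longrightarrow> a N = 0; 0 \<le> L\<rbrakk>
       \<Longrightarrow> rate_finite \<alpha> \<tau> a \<and> rate \<alpha> \<tau> a \<le> C * (real q powr \<alpha> * R + real m powr \<alpha> * L)"
proof (cases "\<tau> = \<infinity>")
  case True
  have "rate_finite \<alpha> \<tau> a \<and> rate \<alpha> \<tau> a \<le> 1 * (real q powr \<alpha> * R + real m powr \<alpha> * L)"
    if a0: "\<And>N. 0 \<le> a N" and aR: "\<And>N. a N \<le> R" and aL: "\<And>N. q \<le> N \<Longrightarrow> a N \<le> L"
      and az: "\<And>N. m \<le> N \<Longrightarrow> a N = 0" and L: "0 \<le> L" for a q m R L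
  proof -
    have R: "0 \<le> R" using a0[of 0] aR[of 0] by simp
    have b: "real N powr \<alpha> * a N \<le> real q powr \<alpha> * R + real m powr \<alpha> * L" for N
    proof -
      consider "N < q" | "q \<le> N" "N < m" | "m \<le> N" by linarith
      then show ?thesis
      proof cases
        case 1
        have "real N powr \<alpha> * a N \<le> real q powr \<alpha> * R"
          using 1 a0 aR assms by (intro mult_mono powr_mono2) auto
        then show ?thesis using L by (simp add: add_increasing2)
      next
        case 2
        have "real N powr \<alpha> * a N \<le> real m powr \<alpha> * L"
          using 2 a0 aL assms by (intro mult_mono powr_mono2) auto
        then show ?thesis using R by (simp add: add_increasing)
      next
        case 3
        then show ?thesis using az R L by simp
      qed
    qed
    then have "rate_finite \<alpha> \<tau> a" using True by (auto simp: rate_finite_def bdd_above_def)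
    moreover have "rate \<alpha> \<tau> a \<le> real q powr \<alpha> * R + real m powr \<alpha> * L"
      using True b by (auto simp: rate_def intro!: cSUP_least)
    ultimately show ?thesis by simp
  qed
  then show ?thesis by (intro that[of 1]) (simp, blast)
next
  case False
  define t where "t = real_of_ereal \<tau>"
  have t: "t > 0" using assms False by (cases \<tau>) (auto simp: t_def)
  define s where "s = \<alpha> * t"
  have s: "s > 0" using t assms by (simp add: s_def)
  define M where "M = max 1 (1 / s)"
  have M: "M > 0" by (simp add: M_def)
  have "rate_finite \<alpha> \<tau> a \<and> rate \<alpha> \<tau> a \<le> (2 * M) powr (1 / t) * (real q powr \<alpha> * R + real m powr \<alpha> * L)"
    if a0: "\<And>N. 0 \<le> a N" and aR: "\<And>N. a N \<le> R" and aL: "\<And>N. q \<le> N \<Longrightarrow> a N \<le> L"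
      and az: "\<And>N. m \<le> N \<Longrightarrow> a N = 0" and L: "0 \<le> L" for a q m R L
  proof -
    have R: "0 \<le> R" using a0[of 0] aR[of 0] by simp
    let ?f = "\<lambda>k. (real (Suc k) powr \<alpha> * a (Suc k)) powr t / real (Suc k)"
    let ?w = "\<lambda>k. real (Suc k) powr (s - 1)"
    let ?u = "real q powr \<alpha> * R" and ?v = "real m powr \<alpha> * L"
    have f0: "?f k = 0" if "k \<notin> {..<m}" for k using that az by simp
    have sums: "?f sums (\<Sum>k<m. ?f k)" using f0 by (intro sums_finite) auto
    have pw: "?f k \<le> (if k < q then ?w k * R powr t else 0) + ?w k * L powr t" for k
    proof -
      have eq: "?f k = ?w k * a (Suc k) powr t" using rate_term_eq[OF a0] by (simp only: s_def)
      show ?thesis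
      proof (cases "k < q")
        case True
        have "?w k * a (Suc k) powr t \<le> ?w k * R powr t"
          using a0 aR t by (intro mult_left_mono powr_mono2) auto
        then show ?thesis using True unfolding eq by (simp add: add_increasing2)
      next
        case False
        have "?w k * a (Suc k) powr t \<le> ?w k * L powr t"
          using a0 aL t False by (intro mult_left_mono powr_mono2) auto
        then show ?thesis using False unfolding eq by simp
      qed
    qed
    have "(\<Sum>k<m. ?f k) \<le> (\<Sum>k<m. (if k < q then ?w k * R powr t else 0) + ?w k * L powr t)"
      by (intro sum_mono pw)
    also have "\<dots> = (\<Sum>k\<in>{..<m} \<inter> {..<q}. ?w k * R powr t) + (\<Sum>k<m. ?w k * L powr t)"
      by (simp add: sum.distrib sum.inter_restrict del: of_nat_Suc)
    also have "\<dots> \<le> (\<Sum>k<q. ?w k * R powr t) + (\<Sum>k<m. ?w k * L powr t)"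
      by (intro add_right_mono sum_mono2) auto
    also have "\<dots> = (\<Sum>k<q. ?w k) * R powr t + (\<Sum>k<m. ?w k) * L powr t"
      by (simp only: sum_distrib_right)
    also have "\<dots> \<le> (M * real q powr s) * R powr t + (M * real m powr s) * L powr t"
      using sum_powr_le[OF s] unfolding M_def by (intro add_mono mult_right_mono) auto
    also have "\<dots> = M * (?u powr t + ?v powr t)"
      using R L by (simp add: powr_mult powr_powr s_def algebra_simps)
    also have "\<dots> \<le> M * ((?u + ?v) powr t + (?u + ?v) powr t)"
      using M R L t by (intro mult_left_mono add_mono powr_mono2) auto
    finally have "(\<Sum>k<m. ?f k) \<le> 2 * M * (?u + ?v) powr t" by simp
    then have "(\<Sum>k<m. ?f k) powr (1 / t) \<le> (2 * M * (?u + ?v) powr t) powr (1 / t)"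
      using t by (intro powr_mono2 sum_nonneg) auto
    also have "\<dots> = (2 * M) powr (1 / t) * (?u + ?v)"
      using t M R L by (simp add: powr_mult powr_powr)
    finally show ?thesis
      using sums_unique[OF sums] sums_summable[OF sums] False by (simp add: rate_def rate_finite_def t_def)
  qed
  then show ?thesis using M by (intro that[of "(2 * M) powr (1 / t)"]) (simp, blast)
qed

section \<open>Indicator vectors of a 1-unconditional basis\<close>

locale one_unconditional_basis = quasi_banach_space scale qnorm \<rho>
  for scale :: "'k::real_normed_field \<Rightarrow> 'b::ab_group_add \<Rightarrow> 'b" and qnorm \<rho> +
  fixes e :: "nat \<Rightarrow> 'b"
  assumes unconditional: "unconditional_basis scale qnorm e 1"
begin

lemma qnorm_zero [simp]: "qnorm 0 = 0"
  using qnorm_eq_0_iff by blast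

lemma qnorm_minus_commute: "qnorm (x - y) = qnorm (y - x)"
proof -
  have "scale (- 1) (x - y) = y - x" by simp
  then show ?thesis using qnorm_scale[of "- 1" "x - y"] by simp
qed

lemma expands_to_unique_sum:
  assumes "expands_to scale qnorm e c x" "expands_to scale qnorm e c y"
  shows "x = y"
proof -
  let ?s = "\<lambda>n. \<Sum>j<n. scale (c j) (e j)"
  have "(\<lambda>n. qnorm (x - ?s n) powr \<rho> + qnorm (y - ?s n) powr \<rho>) \<longlonglongrightarrow> 0 powr \<rho> + 0 powr \<rho>"
    using assms rho_pos qnorm_nonneg unfolding expands_to_def
    by (intro tendsto_add tendsto_powr') auto
  moreover have "qnorm (x - y) powr \<rho> \<le> qnorm (x - ?s n) powr \<rho> + qnorm (y - ?s n) powr \<rho>" for n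
    using qnorm_triangle[of "x - ?s n" "?s n - y"] by (simp add: qnorm_minus_commute[of y])
  ultimately have "qnorm (x - y) powr \<rho> \<le> 0"
    by (intro LIMSEQ_le_const[of _ 0]) auto
  then show ?thesis using qnorm_eq_0_iff[of "x - y"] by simp
qed

lemma expands_to_indicator:
  assumes "finite A"
  shows "expands_to scale qnorm e (\<lambda>j. if j \<in> A then 1 else 0) (sum e A)"
proof -
  obtain m where m: "A \<subseteq> {..<m}" using assms finite_nat_iff_bounded by blast
  have "(\<Sum>j<n. scale (if j \<in> A then 1 else 0) (e j)) = sum e A" if "n \<ge> m" for n
  proof -
    have "(\<Sum>j<n. scale (if j \<in> A then 1 else 0) (e j)) = (\<Sum>j<n. if j \<in> A then e j else 0)"
      by (intro sum.cong) auto
    also have "\<dots> = sum e ({..<n} \<inter> A)" by (simp add: sum.inter_restrict)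
    also have "{..<n} \<inter> A = A" using m that by fastforce
    finally show ?thesis .
  qed
  then show ?thesis unfolding expands_to_def
    by (intro tendsto_eventually) (auto simp: eventually_sequentially intro!: exI[of _ m])
qed

lemma coeffs_indicator:
  assumes "finite A"
  shows "coeffs scale qnorm e (sum e A) = (\<lambda>j. if j \<in> A then 1 else 0)"
proof -
  have "\<exists>!c. expands_to scale qnorm e c (sum e A)"
    using unconditional by (auto simp: unconditional_basis_def is_basis_def)
  then show ?thesis unfolding coeffs_def
    using expands_to_indicator[OF assms] by (intro the1_equality)
qed

lemma support_indicator:
  assumes "finite A"
  shows "{j. coeffs scale qnorm e (sum e A) j \<noteq> 0} = A"
  by (simp add: coeffs_indicator[OF assms])

text \<open>
  Multiplying the coefficients of \<open>1\<^sub>A\<close> by the indicator function of \<open>B\<close> is an admissible choice of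
  multipliers in the definition of unconditionality.
\<close>

lemma qnorm_indicator_mono:
  assumes "finite A" "B \<subseteq> A"
  shows "qnorm (sum e B) \<le> qnorm (sum e A)"
proof -
  let ?l = "\<lambda>j. if j \<in> B then 1 else (0::'k)"
  obtain y where y: "expands_to scale qnorm e (\<lambda>j. ?l j * (if j \<in> A then 1 else 0)) y"
      "qnorm y \<le> 1 * qnorm (sum e A)"
    using unconditional expands_to_indicator[OF assms(1)]
    unfolding unconditional_basis_def by (fastforce dest: spec[of _ ?l])
  have "(\<lambda>j. ?l j * (if j \<in> A then 1 else 0)) = ?l" using assms(2) by (auto simp: fun_eq_iff)
  then have "y = sum e B"
    using y(1) expands_to_indicator[of B] finite_subset[OF assms(2,1)] expands_to_unique_sum by metis
  then show ?thesis using y by simp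
qed

lemma qnorm_add_le:
  assumes "qnorm x \<le> R" "qnorm y \<le> R"
  shows "qnorm (x + y) \<le> 2 powr (1 / \<rho>) * R"
proof -
  have R: "0 \<le> R" using assms qnorm_nonneg[of x] by linarith
  have "qnorm (x + y) powr \<rho> \<le> qnorm x powr \<rho> + qnorm y powr \<rho>" by (rule qnorm_triangle)
  also have "\<dots> \<le> R powr \<rho> + R powr \<rho>"
    using assms qnorm_nonneg rho_pos by (intro add_mono powr_mono2) auto
  finally have "(qnorm (x + y) powr \<rho>) powr (1 / \<rho>) \<le> (2 * R powr \<rho>) powr (1 / \<rho>)"
    using rho_pos by (intro powr_mono2) auto
  then show ?thesis using rho_pos R qnorm_nonneg by (simp add: powr_mult powr_powr)
qed

section \<open>Errors of approximation of an indicator vector\<close>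

lemma sigma_err_le:
  assumes "y \<in> Sigma_set scale qnorm e N"
  shows "sigma_err scale qnorm e N x \<le> qnorm (x - y)"
  unfolding sigma_err_def using assms qnorm_nonneg by (intro cINF_lower) (auto simp: bdd_below_def)

lemma indicator_in_Sigma_set:
  assumes "finite B" "card B \<le> N"
  shows "sum e B \<in> Sigma_set scale qnorm e N"
  using assms by (simp add: Sigma_set_def support_indicator)

lemma sigma_err_nonneg: "0 \<le> sigma_err scale qnorm e N x"
  unfolding sigma_err_def
  using qnorm_nonneg indicator_in_Sigma_set[of "{}" N] by (intro cINF_greatest) auto

lemma sigma_err_indicator_le:
  assumes "finite A" "B \<subseteq> A" "card B \<le> N"
  shows "sigma_err scale qnorm e N (sum e A) \<le> qnorm (sum e (A - B))"
  using sigma_err_le[OF indicator_in_Sigma_set[of B N]] assms finite_subset[of B A]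
  by (simp add: sum_diff)

lemma indicator_minus_greedy_sum:
  assumes "finite A" "inj p"
  shows "sum e A - greedy_sum scale qnorm e p N (sum e A) = sum e (A - p ` {..<N})"
proof -
  have "greedy_sum scale qnorm e p N (sum e A) = (\<Sum>j<N. if p j \<in> A then e (p j) else 0)"
    unfolding greedy_sum_def coeffs_indicator[OF assms(1)] by (intro sum.cong) auto
  also have "\<dots> = (\<Sum>i\<in>p ` {..<N}. if i \<in> A then e i else 0)"
    using assms(2) by (subst sum.reindex) (auto intro: inj_on_subset)
  also have "\<dots> = sum e (p ` {..<N} \<inter> A)" by (simp add: sum.inter_restrict)
  finally show ?thesis
    using assms(1) by (simp add: sum_diff[symmetric] Diff_Int_distrib2 Diff_Int)
qed

text \<open>
  The supremum defining the greedy error is a real one, so that it dominates its members only once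
  they are known to be bounded: all remainders are shorter than \<open>1\<^sub>A\<close> itself.
\<close>

lemma gamma_err_ge:
  assumes "finite A" "greedy_ordering (coeffs scale qnorm e (sum e A)) p"
  shows "qnorm (sum e (A - p ` {..<N})) \<le> gamma_err scale qnorm e N (sum e A)"
proof -
  let ?P = "{p. greedy_ordering (coeffs scale qnorm e (sum e A)) p}"
  let ?g = "\<lambda>p. qnorm (sum e A - greedy_sum scale qnorm e p N (sum e A))"
  have eq: "?g p = qnorm (sum e (A - p ` {..<N}))" if "p \<in> ?P" for p
    using that assms(1) by (simp add: indicator_minus_greedy_sum greedy_ordering_def)
  have "?g p \<le> qnorm (sum e A)" if "p \<in> ?P" for p
    unfolding eq[OF that] using assms(1) by (intro qnorm_indicator_mono) auto
  then have "bdd_above (?g ` ?P)" by (intro bdd_aboveI2[of _ _ "qnorm (sum e A)"]) auto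
  then have "?g p \<le> gamma_err scale qnorm e N (sum e A)"
    unfolding gamma_err_def using assms(2) by (intro cSUP_upper) auto
  then show ?thesis using eq[of p] assms(2) by simp
qed

end

text \<open>A greedy ordering is an infinite enumeration, even of a vector with finite support.\<close>

lemma distinct_list_extends_to_injection:
  fixes xs :: "nat list"
  assumes "distinct xs"
  obtains p where "inj p" "\<And>j. j < length xs \<Longrightarrow> p j = xs ! j"
proof -
  define M where "M = Suc (Max (insert 0 (set xs)))"
  have M: "xs ! j < M" if "j < length xs" for j
    using that by (auto simp: M_def less_Suc_eq_le intro!: Max_ge)
  define p where "p j = (if j < length xs then xs ! j else M + j)" for j
  have "inj p"
  proof (rule injI)
    fix i j assume "p i = p j"
    then show "i = j"
      using M[of i] M[of j] assms
      by (auto simp: p_def nth_eq_iff_index_eq split: if_splits)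
  qed
  then show ?thesis by (rule that) (simp add: p_def)
qed

context one_unconditional_basis
begin

text \<open>
  All nonzero coefficients of \<open>1\<^sub>A\<close> are equal, hence an enumeration that exhausts \<open>A - F\<close>, then \<open>F\<close>,
  and then moves outside \<open>A\<close> is a greedy ordering; it does not touch \<open>F\<close> in the first
  \<open>card (A - F)\<close> steps.
\<close>

lemma gamma_err_indicator_ge:
  assumes "finite A" "F \<subseteq> A" "N \<le> card (A - F)"
  shows "qnorm (sum e F) \<le> gamma_err scale qnorm e N (sum e A)"
proof -
  obtain ds where ds: "set ds = A - F" "distinct ds"
    using finite_distinct_list[of "A - F"] assms by auto
  obtain fs where fs: "set fs = F" "distinct fs"
    using finite_distinct_list[of F] assms finite_subset by metis
  obtain p where p: "inj p" "\<And>j. j < length (ds @ fs) \<Longrightarrow> p j = (ds @ fs) ! j"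
    by (rule distinct_list_extends_to_injection[of "ds @ fs"]) (use ds fs in auto)
  have A: "A = set (ds @ fs)" using ds fs assms by auto
  have pA: "p j \<in> A \<longleftrightarrow> j < length (ds @ fs)" for j
  proof
    assume "p j \<in> A"
    then obtain i where "i < length (ds @ fs)" "p j = p i"
      unfolding A by (metis in_set_conv_nth p(2))
    then show "j < length (ds @ fs)" using injD[OF p(1)] by metis
  next
    assume "j < length (ds @ fs)"
    then show "p j \<in> A" unfolding A using p(2) nth_mem by metis
  qed
  have "greedy_ordering (coeffs scale qnorm e (sum e A)) p"
    unfolding greedy_ordering_def support_indicator[OF assms(1)]
  proof (intro conjI allI)
    show "A \<subseteq> range p"
      unfolding A by (metis in_set_conv_nth p(2) rangeI subsetI)
    show "norm (coeffs scale qnorm e (sum e A) (p (Suc j))) \<le> norm (coeffs scale qnorm e (sum e A) (p j))" for j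
      by (simp add: coeffs_indicator[OF assms(1)] pA)
  qed (rule p(1))
  then have "qnorm (sum e (A - p ` {..<N})) \<le> gamma_err scale qnorm e N (sum e A)"
    by (rule gamma_err_ge[OF assms(1)])
  moreover have "F \<subseteq> A - p ` {..<N}"
  proof -
    have "N \<le> length ds" using assms(3) ds by (metis distinct_card)
    then have "p ` {..<N} \<subseteq> A - F"
      using p(2) ds(1) nth_mem by (fastforce simp: nth_append)
    then show ?thesis using assms(2) by auto
  qed
  then have "qnorm (sum e F) \<le> qnorm (sum e (A - p ` {..<N}))"
    using assms(1) by (intro qnorm_indicator_mono) auto
  ultimately show ?thesis by linarith
qed

section \<open>Unbalanced index sets separate the two spaces\<close>

text \<open>
  For fixed \<open>k\<close>, the factor \<open>k\<close> in the size of \<open>A\<close> costs only the constant \<open>k\<^sup>\<beta>\<^sup>0\<close>, whereas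
  \<open>q\<^sup>\<beta>\<^sup>1\<^sup>-\<^sup>\<beta>\<^sup>0\<close> grows without bound.
\<close>

lemma unbalanced_index_sets:
  assumes \<beta>: "\<beta>\<^sub>0 < \<beta>\<^sub>1"
    and l: "h_left qnorm e \<lesssim> (\<lambda>N. real N powr \<beta>\<^sub>0)"
    and r: "(\<lambda>N. real N powr \<beta>\<^sub>1) \<lesssim> h_right qnorm e"
    and "\<delta> > 0" and k: "k \<ge> 1"
  obtains q A B where "q \<ge> 1" "finite A" "card A = k * q" "finite B" "card B = q"
    "qnorm (sum e B) > 0" "qnorm (sum e A) \<le> \<delta> * qnorm (sum e B)"
proof -
  obtain C where C: "C > 0" "\<And>N. N \<ge> 1 \<Longrightarrow> h_left qnorm e N \<le> C * real N powr \<beta>\<^sub>0"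
    using l unfolding lesssim_def by blast
  obtain D where D: "D > 0" "\<And>N. N \<ge> 1 \<Longrightarrow> real N powr \<beta>\<^sub>1 \<le> D * h_right qnorm e N"
    using r unfolding lesssim_def by blast
  \<comment> \<open>The factor \<open>4\<close> leaves a factor \<open>2\<close> for each of the two democracy functions, whose infimum and
    supremum need not be attained.\<close>
  define T where "T = 4 * C * D * real k powr \<beta>\<^sub>0 / \<delta>"
  obtain q :: nat where q: "T \<le> real q powr (\<beta>\<^sub>1 - \<beta>\<^sub>0)" "q \<ge> 1"
    by (rule nat_powr_unbounded[of "\<beta>\<^sub>1 - \<beta>\<^sub>0" T]) (use \<beta> in simp)
  have ne: "(\<lambda>\<Gamma>. qnorm (sum e \<Gamma>)) ` {\<Gamma>. finite \<Gamma> \<and> card \<Gamma> = N} \<noteq> {}" for N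
    by (auto intro!: exI[of _ "{..<N}"])
  have "h_left qnorm e (k * q) < 2 * C * real (k * q) powr \<beta>\<^sub>0"
  proof -
    have "C * real (k * q) powr \<beta>\<^sub>0 > 0" using C q k by simp
    then show ?thesis using C(2)[of "k * q"] q k by simp
  qed
  then obtain A where A: "finite A" "card A = k * q" "qnorm (sum e A) < 2 * C * real (k * q) powr \<beta>\<^sub>0"
    unfolding h_left_def using cInf_lessD[OF ne[of "k * q"]] by blast
  have "real q powr \<beta>\<^sub>1 / (2 * D) < h_right qnorm e q"
  proof -
    have "real q powr \<beta>\<^sub>1 > 0" using q by simp
    then have "real q powr \<beta>\<^sub>1 < 2 * D * h_right qnorm e q" using D(2)[of q] q by linarith
    then show ?thesis using D by (simp add: field_simps)
  qed
  then obtain B where B: "finite B" "card B = q" "real q powr \<beta>\<^sub>1 / (2 * D) < qnorm (sum e B)"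
    unfolding h_right_def using less_cSupD[OF ne[of q]] by blast
  have "2 * C * real (k * q) powr \<beta>\<^sub>0 = T * real q powr \<beta>\<^sub>0 * \<delta> / (2 * D)"
    using D \<open>\<delta> > 0\<close> by (simp add: T_def powr_mult)
  also have "\<dots> \<le> real q powr (\<beta>\<^sub>1 - \<beta>\<^sub>0) * real q powr \<beta>\<^sub>0 * \<delta> / (2 * D)"
    using q D \<open>\<delta> > 0\<close> by (intro divide_right_mono mult_right_mono) auto
  also have "\<dots> = \<delta> * (real q powr \<beta>\<^sub>1 / (2 * D))" by (simp add: powr_add[symmetric])
  also have "\<dots> \<le> \<delta> * qnorm (sum e B)" using B \<open>\<delta> > 0\<close> by (intro mult_left_mono) auto
  finally have AB: "qnorm (sum e A) \<le> \<delta> * qnorm (sum e B)" using A by simp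
  have "0 \<le> real q powr \<beta>\<^sub>1 / (2 * D)" using D by simp
  then have "qnorm (sum e B) > 0" using B by linarith
  then show ?thesis using that[OF q(2) A(1,2) B(1,2) _ AB] by blast
qed

lemma approx_space_not_embeds_greedy_class:
  assumes \<beta>: "\<beta>\<^sub>0 < \<beta>\<^sub>1"
    and l: "h_left qnorm e \<lesssim> (\<lambda>N. real N powr \<beta>\<^sub>0)"
    and r: "(\<lambda>N. real N powr \<beta>\<^sub>1) \<lesssim> h_right qnorm e"
    and \<alpha>: "\<alpha> > 0" and \<tau>: "\<tau> > 0"
  shows "\<not> approx_space scale qnorm e \<alpha> \<tau> \<hookrightarrow> greedy_class scale qnorm e \<alpha> \<tau>"
proof
  let ?\<sigma> = "\<lambda>x N. sigma_err scale qnorm e N x" and ?\<gamma> = "\<lambda>x N. gamma_err scale qnorm e N x"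
  assume "approx_space scale qnorm e \<alpha> \<tau> \<hookrightarrow> greedy_class scale qnorm e \<alpha> \<tau>"
  then obtain K where K: "K > 0"
    and emb: "\<And>x. rate_finite \<alpha> \<tau> (?\<sigma> x) \<Longrightarrow> rate_finite \<alpha> \<tau> (?\<gamma> x)"
      "\<And>x. rate_finite \<alpha> \<tau> (?\<sigma> x) \<Longrightarrow>
        qnorm x + rate \<alpha> \<tau> (?\<gamma> x) \<le> K * (qnorm x + rate \<alpha> \<tau> (?\<sigma> x))"
    unfolding embeds_def approx_space_def greedy_class_def by auto
  obtain c where c: "c > 0"
    "\<And>a n R. \<lbrakk>rate_finite \<alpha> \<tau> a; R \<ge> 0; \<And>N. 1 \<le> N \<Longrightarrow> N \<le> n \<Longrightarrow> R \<le> a N; n \<ge> 1\<rbrakk>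
       \<Longrightarrow> c * real n powr \<alpha> * R \<le> rate \<alpha> \<tau> a"
    using rate_lower_bound[OF \<alpha> \<tau>] by blast
  obtain C where C: "C > 0"
    "\<And>a q m R L. \<lbrakk>\<And>N. 0 \<le> a N; \<And>N. a N \<le> R; \<And>N. q \<le> N \<Longrightarrow> a N \<le> L;
        \<And>N. m \<le> N \<Longrightarrow> a N = 0; 0 \<le> L\<rbrakk>
       \<Longrightarrow> rate_finite \<alpha> \<tau> a \<and> rate \<alpha> \<tau> a \<le> C * (real q powr \<alpha> * R + real m powr \<alpha> * L)"
    using rate_upper_bound[OF \<alpha> \<tau>] by blast
  define M where "M = 2 powr (1 / \<rho>)"
  \<comment> \<open>The right-hand side is free of \<open>k\<close>, which is absurd for large \<open>k\<close>.\<close>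
  have key: "c * real k powr \<alpha> \<le> K * (M + C * (M + 1))" if k: "k \<ge> 1" for k
  proof -
    \<comment> \<open>This makes the plateau of height \<open>\<delta> R\<close> up to \<open>(k + 2) q\<close> as cheap as one of height \<open>R\<close> up to \<open>q\<close>.\<close>
    define \<delta> where "\<delta> = real (k + 2) powr - \<alpha>"
    have \<delta>: "\<delta> > 0" "\<delta> \<le> 1" using \<alpha> by (auto simp: \<delta>_def powr_minus_divide intro: ge_one_powr_ge_zero)
    \<comment> \<open>\<open>G\<close> and \<open>F\<close> may overlap; with \<open>k + 1\<close> instead of \<open>k\<close>, at least \<open>k q\<close> indices of \<open>G\<close> lie
      outside \<open>F\<close>.\<close>
    obtain q G F where q: "q \<ge> 1" and G: "finite G" "card G = (k + 1) * q"
      and F: "finite F" "card F = q" "qnorm (sum e F) > 0"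
      and GF: "qnorm (sum e G) \<le> \<delta> * qnorm (sum e F)"
      using unbalanced_index_sets[OF \<beta> l r \<delta>(1), of "k + 1"] by auto
    define R where "R = qnorm (sum e F)"
    define A where "A = G \<union> F"
    define x where "x = sum e A"
    have R: "R > 0" using F by (simp add: R_def)
    have A: "finite A" "F \<subseteq> A" using G F by (auto simp: A_def)
    have AF: "A - F = G - F" by (auto simp: A_def)
    have GmF: "qnorm (sum e (A - F)) \<le> \<delta> * R"
      using qnorm_indicator_mono[of G "G - F"] G GF unfolding AF R_def by auto
    have "\<delta> * R \<le> R" using \<delta> R by simp
    then have xM: "qnorm x \<le> M * R"
      using qnorm_add_le[of "sum e (A - F)" R "sum e F"] GmF A
      by (simp add: x_def M_def sum_diff finite_subset R_def)
    have \<sigma>: "rate_finite \<alpha> \<tau> (?\<sigma> x) \<and>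
        rate \<alpha> \<tau> (?\<sigma> x) \<le> C * (real q powr \<alpha> * (M * R) + real ((k + 2) * q) powr \<alpha> * (\<delta> * R))"
    proof (rule C(2))
      show "?\<sigma> x N \<le> M * R" for N
        using sigma_err_indicator_le[of A "{}" N] A xM by (simp add: x_def)
      show "?\<sigma> x N \<le> \<delta> * R" if "q \<le> N" for N
        using sigma_err_indicator_le[of A F N] A F that GmF by (simp add: x_def)
      show "?\<sigma> x N = 0" if "(k + 2) * q \<le> N" for N
      proof -
        have "card A \<le> N" using card_Un_le[of G F] G F that by (simp add: A_def)
        then show ?thesis
          using sigma_err_indicator_le[of A A N] A sigma_err_nonneg[of N x] by (simp add: x_def)
      qed
    qed (use sigma_err_nonneg R \<delta> in auto)
    have "real ((k + 2) * q) powr \<alpha> * (\<delta> * R) = real q powr \<alpha> * R"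
    proof -
      have "real (k + 2) powr \<alpha> * \<delta> = 1" by (simp add: \<delta>_def powr_add[symmetric])
      then show ?thesis by (simp only: of_nat_mult powr_mult) (simp add: algebra_simps)
    qed
    then have \<sigma>_le: "rate \<alpha> \<tau> (?\<sigma> x) \<le> C * ((M + 1) * (real q powr \<alpha> * R))"
      using \<sigma> by (simp only: distrib_left distrib_right mult_1_left mult.assoc mult.left_commute)
    have "c * real (k * q) powr \<alpha> * R \<le> rate \<alpha> \<tau> (?\<gamma> x)"
    proof (rule c(2))
      show "rate_finite \<alpha> \<tau> (?\<gamma> x)" using \<sigma> emb by blast
      show "R \<le> ?\<gamma> x N" if "N \<le> k * q" for N
      proof -
        have "k * q \<le> card (A - F)"
          using diff_card_le_card_Diff[of F G] F G unfolding AF by simp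
        then show ?thesis
          using gamma_err_indicator_ge[of A F N] A that by (simp add: R_def x_def)
      qed
    qed (use R k q in auto)
    also have "\<dots> \<le> K * (qnorm x + rate \<alpha> \<tau> (?\<sigma> x))"
      using emb(2)[of x] \<sigma> qnorm_nonneg[of x] by linarith
    also have "\<dots> \<le> K * (M * (real q powr \<alpha> * R) + C * ((M + 1) * (real q powr \<alpha> * R)))"
    proof -
      have "1 \<le> real q powr \<alpha>" using q \<alpha> by (intro ge_one_powr_ge_zero) auto
      then have "M * R \<le> M * (real q powr \<alpha> * R)" using R by (simp add: M_def)
      then show ?thesis using xM \<sigma>_le K by (intro mult_left_mono add_mono) auto
    qed
    finally have "(c * real k powr \<alpha>) * (real q powr \<alpha> * R) \<le> (K * (M + C * (M + 1))) * (real q powr \<alpha> * R)"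
      by (simp add: powr_mult algebra_simps)
    moreover have "0 < real q powr \<alpha> * R" using q R by simp
    ultimately show ?thesis by (rule mult_right_le_imp_le)
  qed
  obtain k :: nat where k: "K * (M + C * (M + 1)) / c + 1 \<le> real k powr \<alpha>" "k \<ge> 1"
    by (rule nat_powr_unbounded[OF \<alpha>])
  have "K * (M + C * (M + 1)) / c < real k powr \<alpha>" using k by simp
  then have "K * (M + C * (M + 1)) < c * real k powr \<alpha>" using c(1) by (simp add: field_simps)
  then show False using key[OF k(2)] by linarith
qed

end

theorem corollary7p2:
  fixes scale :: "'k::real_normed_field \<Rightarrow> 'b::ab_group_add \<Rightarrow> 'b"
    and qnorm :: "'b \<Rightarrow> real" and \<rho> :: real and e :: "nat \<Rightarrow> 'b"
    and \<beta>\<^sub>0 \<beta>\<^sub>1 :: real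
  assumes "quasi_banach_space scale qnorm \<rho>"
    and "unconditional_basis scale qnorm e 1"
    and "\<And>j. qnorm (e j) = 1"
    and "0 \<le> \<beta>\<^sub>0" and "\<beta>\<^sub>0 < \<beta>\<^sub>1"
    and "h_left qnorm e \<lesssim> (\<lambda>N. real N powr \<beta>\<^sub>0)"
    and "(\<lambda>N. real N powr \<beta>\<^sub>1) \<lesssim> h_right qnorm e"
  shows "\<forall>\<alpha>>0. \<forall>\<tau>>0. \<not> same_space (greedy_class scale qnorm e \<alpha> \<tau>) (approx_space scale qnorm e \<alpha> \<tau>)"
proof -
  interpret one_unconditional_basis scale qnorm \<rho> e
    using assms(1,2) by (intro one_unconditional_basis.intro one_unconditional_basis_axioms.intro)
  show ?thesis
    using approx_space_not_embeds_greedy_class[OF assms(5-7)] by (auto simp: same_space_def)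
qed

end
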